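(* Consider the primal-dual pair (P)-(D) of multifold linear conic problems described in the context, and assume that strong duality holds for (P)-(D). If for every $j\in J$ the cone $K_j$ is a Lorentz cone, then $$R=C=J\setminus(B^0\cup N^0),$$ where $R$, $C$, $B^0$, $N^0$ are the index sets defined in the context.
   Context: Lorentz cones: $L_0=\mathbb{R}_+\subset\mathbb{R}$, and for $n\ge 1$, $L_n=\{(x_0,\bar x)\in\mathbb{R}\times\mathbb{R}^n: x_0\ge\|\bar x\|\}$ with $\|\cdot\|$ the Euclidean norm. Let $J=\{1,\dots,r\}$. For each $j\in J$ let $K_j\subset\mathbb{R}^{q_j}$ ($q_j\ge 1$) be a closed convex regular cone (regular: nonempty interior and pointed), $A^j\in\mathbb{R}^{q_j\times n}$, $b^j\in\mathbb{R}^{q_j}$, and let $c\in\mathbb{R}^n$. Let $A$ be the matrix obtained by stacking $A^1,\dots,A^r$ vertically. For a set $Q\subseteq \mathbb{R}^m$, $Q^+=\{y\in\mathbb{R}^m : y^\top z\ge 0\ \forall z\in Q\}$. The problems are $$(P)\quad \min_{x\in\mathbb{R}^n} c^\top x\ \text{ s.t. } A^jx-b^j\in K_j\ \ \forall j\in J,$$ $$(D)\quad \max_{y=(y^1,\dots,y^r)} \sum_{j=1}^r (b^j)^\top y^j\ \text{ s.t. } \sum_{j=1}^r (A^j)^\top y^j=c,\ \ y^j\in K_j^+\ \ \forall j\in J.$$ Strong duality for (P)-(D) means that both optimal solution sets are nonempty and the duality gap is zero. Let $S(C)$ be the set of pairs $(x,y)$ satisfying: $A^jx-b^j\in K_j$,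 $y^j\in K_j^+$, $(y^j)^\top(A^jx-b^j)=0$ for all $j\in J$, and $A^\top y=c$. Under strong duality $S(C)$ is the product of the optimal solution sets of (P) and (D). For a closed convex cone $Q$ and $s\in Q$, $N_Q(s)=\{v: v^\top(z-s)\le 0\ \forall z\in Q\}$ is the normal cone; $\operatorname{ri}$ is relative interior, $\operatorname{int}$ is interior. Index sets: $B=\{j\in J:\exists (x,y)\in S(C),\ A^jx-b^j\in\operatorname{int}K_j\}$, $N=\{j\in J:\exists (x,y)\in S(C),\ y^j\in\operatorname{int}K_j^+\}$, $R^0=\{j\in J:\exists (x,y)\in S(C),\ -y^j\in\operatorname{ri}N_{K_j}(A^jx-b^j)\}$, $R=R^0\setminus(B\cup N)$, $B^0=\{j\in J: y^j=0\ \forall (x,y)\in S(C)\}$, $N^0=\{j\in J: A^jx-b^j=0\ \forall (x,y)\in S(C)\}$, $C=J\setminus(B^0\cup N^0)$. *)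

theory Defs
  imports
    "HOL-Analysis.Abstract_Metric_Spaces"
    "HOL-Analysis.L2_Norm"
    "HOL-Library.Extended_Real"
    "Jordan_Normal_Form.Matrix"
begin

unbundle no vec_syntax and no inner_syntax

section \<open>Euclidean space of variable dimension\<close>

text \<open>
  The dimensions of the blocks vary with the block index, so the space of dimension \<open>m\<close> is
  rendered as \<open>carrier_vec m\<close>. That carrier has no type-class topology or vector space
  structure; topological notions come from the abstract Euclidean metric space on it.
\<close>

definition euclid_norm :: "real vec \<Rightarrow> real" where
  "euclid_norm v = L2_set (\<lambda>i. v $ i) {..<dim_vec v}"

text \<open>
  The locale \<open>Metric_space\<close> requires the distance to be symmetric on the whole type, which fails
  for the norm of \<open>u - v\<close> when \<open>u\<close> and \<open>v\<close> have different lengths; hence the coordinates are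
  spelled out here.
\<close>

definition euclid_dist :: "nat \<Rightarrow> real vec \<Rightarrow> real vec \<Rightarrow> real" where
  "euclid_dist m u v = L2_set (\<lambda>i. u $ i - v $ i) {..<m}"

lemma Metric_space_euclid: "Metric_space (carrier_vec m) (euclid_dist m)"
proof
  fix x y z :: "real vec"
  show "0 \<le> euclid_dist m x y"
    by (simp add: euclid_dist_def)
  show "euclid_dist m x y = euclid_dist m y x"
    by (simp add: euclid_dist_def L2_set_def power2_commute)
  show "euclid_dist m x y = 0 \<longleftrightarrow> x = y" if "x \<in> carrier_vec m" "y \<in> carrier_vec m"
    using that by (auto simp: euclid_dist_def L2_set_eq_0_iff)
  show "euclid_dist m x z \<le> euclid_dist m x y + euclid_dist m y z"
    using L2_set_triangle_ineq[of "\<lambda>i. x $ i - y $ i" "\<lambda>i. y $ i - z $ i" "{..<m}"]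
    by (simp add: euclid_dist_def)
qed

definition euclid_top :: "nat \<Rightarrow> real vec topology" where
  "euclid_top m = Metric_space.mtopology (carrier_vec m) (euclid_dist m)"

definition affine_in :: "nat \<Rightarrow> real vec set \<Rightarrow> bool" where
  "affine_in m T \<longleftrightarrow> T \<subseteq> carrier_vec m \<and>
     (\<forall>x\<in>T. \<forall>y\<in>T. \<forall>u v. u + v = 1 \<longrightarrow> u \<cdot>\<^sub>v x + v \<cdot>\<^sub>v y \<in> T)"

definition convex_in :: "nat \<Rightarrow> real vec set \<Rightarrow> bool" where
  "convex_in m T \<longleftrightarrow> T \<subseteq> carrier_vec m \<and>
     (\<forall>x\<in>T. \<forall>y\<in>T. \<forall>u\<ge>0. \<forall>v\<ge>0. u + v = 1 \<longrightarrow> u \<cdot>\<^sub>v x + v \<cdot>\<^sub>v y \<in> T)"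

definition rel_interior_in :: "nat \<Rightarrow> real vec set \<Rightarrow> real vec set" where
  "rel_interior_in m Q = subtopology (euclid_top m) (affine_in m hull Q) interior_of Q"

section \<open>Cones\<close>

definition cone_in :: "nat \<Rightarrow> real vec set \<Rightarrow> bool" where
  "cone_in m Q \<longleftrightarrow> Q \<subseteq> carrier_vec m \<and> Q \<noteq> {} \<and> (\<forall>x\<in>Q. \<forall>t\<ge>0. t \<cdot>\<^sub>v x \<in> Q)"

definition regular_cone :: "nat \<Rightarrow> real vec set \<Rightarrow> bool" where
  "regular_cone m Q \<longleftrightarrow>
     cone_in m Q \<and> convex_in m Q \<and> closedin (euclid_top m) Q \<and>
     euclid_top m interior_of Q \<noteq> {} \<and> Q \<inter> uminus ` Q = {0\<^sub>v m}"

definition dual_cone :: "nat \<Rightarrow> real vec set \<Rightarrow> real vec set" where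
  "dual_cone m Q = {y \<in> carrier_vec m. \<forall>z\<in>Q. y \<bullet> z \<ge> 0}"

definition normal_cone :: "nat \<Rightarrow> real vec set \<Rightarrow> real vec \<Rightarrow> real vec set" where
  "normal_cone m Q s = {v \<in> carrier_vec m. \<forall>z\<in>Q. v \<bullet> (z - s) \<le> 0}"

text \<open>
  \<open>lorentz_cone n\<close> lives in dimension \<open>n + 1\<close>; \<open>vec_last x n\<close> is the vector of the last \<open>n\<close>
  coordinates of \<open>x\<close>. For \<open>n = 0\<close> that vector is empty, with norm \<open>0\<close>, and the cone is the
  half line of nonnegative reals.
\<close>

definition lorentz_cone :: "nat \<Rightarrow> real vec set" where
  "lorentz_cone n = {x \<in> carrier_vec (Suc n). x $ 0 \<ge> euclid_norm (vec_last x n)}"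

section \<open>Multifold conic problems\<close>

record conic_problem =
  nvars :: nat
  nblocks :: nat
  bdim :: "nat \<Rightarrow> nat"
  Kcone :: "nat \<Rightarrow> real vec set"
  Amat :: "nat \<Rightarrow> real mat"
  bvec :: "nat \<Rightarrow> real vec"
  cvec :: "real vec"

definition blocks :: "conic_problem \<Rightarrow> nat set" where
  "blocks P = {1..nblocks P}"

definition conic_problem_wf :: "conic_problem \<Rightarrow> bool" where
  "conic_problem_wf P \<longleftrightarrow>
     cvec P \<in> carrier_vec (nvars P) \<and>
     (\<forall>j\<in>blocks P. bdim P j \<ge> 1 \<and> regular_cone (bdim P j) (Kcone P j) \<and>
        Amat P j \<in> carrier_mat (bdim P j) (nvars P) \<and> bvec P j \<in> carrier_vec (bdim P j))"

definition slack :: "conic_problem \<Rightarrow> real vec \<Rightarrow> nat \<Rightarrow> real vec" where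
  "slack P x j = Amat P j *\<^sub>v x - bvec P j"

text \<open>The product of the transpose of the vertically stacked matrix with a stacked vector:\<close>

definition adjoint_sum :: "conic_problem \<Rightarrow> (nat \<Rightarrow> real vec) \<Rightarrow> real vec" where
  "adjoint_sum P y =
     finsum_vec TYPE(real) (nvars P) (\<lambda>j. transpose_mat (Amat P j) *\<^sub>v y j) (blocks P)"

definition primal_objective :: "conic_problem \<Rightarrow> real vec \<Rightarrow> real" where
  "primal_objective P x = cvec P \<bullet> x"

definition dual_objective :: "conic_problem \<Rightarrow> (nat \<Rightarrow> real vec) \<Rightarrow> real" where
  "dual_objective P y = (\<Sum>j\<in>blocks P. bvec P j \<bullet> y j)"

definition primal_feasible :: "conic_problem \<Rightarrow> real vec set" where
  "primal_feasible P =
     {x \<in> carrier_vec (nvars P). \<forall>j\<in>blocks P. slack P x j \<in> Kcone P j}"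

definition dual_feasible :: "conic_problem \<Rightarrow> (nat \<Rightarrow> real vec) set" where
  "dual_feasible P =
     {y \<in> (\<Pi>\<^sub>E j\<in>blocks P. carrier_vec (bdim P j)).
        adjoint_sum P y = cvec P \<and> (\<forall>j\<in>blocks P. y j \<in> dual_cone (bdim P j) (Kcone P j))}"

definition primal_optimal :: "conic_problem \<Rightarrow> real vec set" where
  "primal_optimal P =
     {x \<in> primal_feasible P. \<forall>z\<in>primal_feasible P. primal_objective P x \<le> primal_objective P z}"

definition dual_optimal :: "conic_problem \<Rightarrow> (nat \<Rightarrow> real vec) set" where
  "dual_optimal P =
     {y \<in> dual_feasible P. \<forall>w\<in>dual_feasible P. dual_objective P w \<le> dual_objective P y}"

definition primal_value :: "conic_problem \<Rightarrow> ereal" where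
  "primal_value P = (INF x\<in>primal_feasible P. ereal (primal_objective P x))"

definition dual_value :: "conic_problem \<Rightarrow> ereal" where
  "dual_value P = (SUP y\<in>dual_feasible P. ereal (dual_objective P y))"

definition strong_duality :: "conic_problem \<Rightarrow> bool" where
  "strong_duality P \<longleftrightarrow>
     primal_optimal P \<noteq> {} \<and> dual_optimal P \<noteq> {} \<and> primal_value P = dual_value P"

definition complementary_solutions :: "conic_problem \<Rightarrow> (real vec \<times> (nat \<Rightarrow> real vec)) set" where
  "complementary_solutions P =
     {(x, y). x \<in> carrier_vec (nvars P) \<and> y \<in> (\<Pi>\<^sub>E j\<in>blocks P. carrier_vec (bdim P j)) \<and>
        (\<forall>j\<in>blocks P. slack P x j \<in> Kcone P j \<and> y j \<in> dual_cone (bdim P j) (Kcone P j) \<and>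
           y j \<bullet> slack P x j = 0) \<and>
        adjoint_sum P y = cvec P}"

section \<open>Index sets\<close>

definition B_set :: "conic_problem \<Rightarrow> nat set" where
  "B_set P = {j \<in> blocks P. \<exists>(x, y)\<in>complementary_solutions P.
     slack P x j \<in> euclid_top (bdim P j) interior_of Kcone P j}"

definition N_set :: "conic_problem \<Rightarrow> nat set" where
  "N_set P = {j \<in> blocks P. \<exists>(x, y)\<in>complementary_solutions P.
     y j \<in> euclid_top (bdim P j) interior_of dual_cone (bdim P j) (Kcone P j)}"

definition R0_set :: "conic_problem \<Rightarrow> nat set" where
  "R0_set P = {j \<in> blocks P. \<exists>(x, y)\<in>complementary_solutions P.
     - y j \<in> rel_interior_in (bdim P j) (normal_cone (bdim P j) (Kcone P j) (slack P x j))}"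

definition R_set :: "conic_problem \<Rightarrow> nat set" where
  "R_set P = R0_set P - (B_set P \<union> N_set P)"

definition B0_set :: "conic_problem \<Rightarrow> nat set" where
  "B0_set P = {j \<in> blocks P. \<forall>(x, y)\<in>complementary_solutions P. y j = 0\<^sub>v (bdim P j)}"

definition N0_set :: "conic_problem \<Rightarrow> nat set" where
  "N0_set P = {j \<in> blocks P. \<forall>(x, y)\<in>complementary_solutions P. slack P x j = 0\<^sub>v (bdim P j)}"

definition C_set :: "conic_problem \<Rightarrow> nat set" where
  "C_set P = blocks P - (B0_set P \<union> N0_set P)"

section \<open>Sanity checks\<close>

lemma euclid_norm_scalar_prod: "euclid_norm v = sqrt (v \<bullet> v)"
  by (simp add: euclid_norm_def L2_set_def scalar_prod_def power2_eq_square atLeast0LessThan)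

lemma euclid_dist_eq_norm:
  assumes "v \<in> carrier_vec m"
  shows "euclid_dist m u v = euclid_norm (u - v)"
  unfolding euclid_dist_def euclid_norm_def using assms by (auto intro!: L2_set_cong)

lemma openin_euclid_top:
  "openin (euclid_top m) U \<longleftrightarrow>
     U \<subseteq> carrier_vec m \<and>
     (\<forall>x\<in>U. \<exists>e>0. \<forall>y\<in>carrier_vec m. euclid_dist m x y < e \<longrightarrow> y \<in> U)"
proof -
  interpret E: Metric_space "carrier_vec m" "euclid_dist m"
    by (rule Metric_space_euclid)
  show ?thesis
    unfolding euclid_top_def E.openin_mtopology subset_iff E.in_mball by blast
qed

lemma topspace_euclid_top: "topspace (euclid_top m) = carrier_vec m"
  unfolding euclid_top_def by (simp add: Metric_space.topspace_mtopology[OF Metric_space_euclid])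

lemma lorentz_cone_iff:
  "x \<in> lorentz_cone n \<longleftrightarrow>
     x \<in> carrier_vec (Suc n) \<and> L2_set (\<lambda>i. x $ Suc i) {..<n} \<le> x $ 0"
proof -
  have "euclid_norm (vec_last x n) = L2_set (\<lambda>i. x $ Suc i) {..<n}"
    if "x \<in> carrier_vec (Suc n)"
    using that unfolding euclid_norm_def by (auto intro!: L2_set_cong simp: vec_last_def)
  then show ?thesis
    by (auto simp: lorentz_cone_def)
qed

lemma lorentz_cone_0: "x \<in> lorentz_cone 0 \<longleftrightarrow> x \<in> carrier_vec 1 \<and> x $ 0 \<ge> 0"
  by (simp add: lorentz_cone_iff)

lemma euclid_dist_Suc:
  "\<bar>u $ 0 - v $ 0\<bar> \<le> euclid_dist (Suc n) u v"
  "L2_set (\<lambda>i. u $ Suc i - v $ Suc i) {..<n} \<le> euclid_dist (Suc n) u v"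
proof -
  have *: "(\<Sum>i<Suc n. (u $ i - v $ i)\<^sup>2) =
      (u $ 0 - v $ 0)\<^sup>2 + (\<Sum>i<n. (u $ Suc i - v $ Suc i)\<^sup>2)"
    by (rule sum.lessThan_Suc_shift)
  have "0 \<le> (\<Sum>i<n. (u $ Suc i - v $ Suc i)\<^sup>2)"
    by (intro sum_nonneg) simp
  then show "\<bar>u $ 0 - v $ 0\<bar> \<le> euclid_dist (Suc n) u v"
    unfolding euclid_dist_def L2_set_def * by (intro real_le_rsqrt) simp
  show "L2_set (\<lambda>i. u $ Suc i - v $ Suc i) {..<n} \<le> euclid_dist (Suc n) u v"
    unfolding euclid_dist_def L2_set_def * by simp
qed

lemma openin_strict_lorentz:
  "openin (euclid_top (Suc n))
     {x \<in> carrier_vec (Suc n). L2_set (\<lambda>i. x $ Suc i) {..<n} < x $ 0}"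
  unfolding openin_euclid_top
proof (intro conjI ballI, goal_cases)
  case (2 x)
  define e where "e = (x $ 0 - L2_set (\<lambda>i. x $ Suc i) {..<n}) / 2"
  have "L2_set (\<lambda>i. y $ Suc i) {..<n} < y $ 0" if "euclid_dist (Suc n) x y < e" for y
    using that euclid_dist_Suc[where u=x and v=y and n=n]
      L2_set_triangle_ineq[of "\<lambda>i. x $ Suc i" "\<lambda>i. y $ Suc i - x $ Suc i" "{..<n}"]
    by (simp add: e_def L2_set_def power2_commute)
  moreover have "e > 0"
    using 2 by (simp add: e_def)
  ultimately show ?case
    by auto
qed auto

lemma openin_complement_lorentz:
  "openin (euclid_top (Suc n)) (carrier_vec (Suc n) - lorentz_cone n)"
  unfolding openin_euclid_top
proof (intro conjI ballI, goal_cases)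
  case (2 x)
  define e where "e = (L2_set (\<lambda>i. x $ Suc i) {..<n} - x $ 0) / 2"
  have "y $ 0 < L2_set (\<lambda>i. y $ Suc i) {..<n}" if "euclid_dist (Suc n) x y < e" for y
    using that euclid_dist_Suc[where u=x and v=y and n=n]
      L2_set_triangle_ineq[of "\<lambda>i. y $ Suc i" "\<lambda>i. x $ Suc i - y $ Suc i" "{..<n}"]
    by (simp add: e_def)
  moreover have "e > 0"
    using 2 by (auto simp: e_def lorentz_cone_iff)
  ultimately show ?case
    by (force simp: lorentz_cone_iff)
qed auto

lemma cone_lorentz: "cone_in (Suc n) (lorentz_cone n)"
proof -
  have "0\<^sub>v (Suc n) \<in> lorentz_cone n"
    by (simp add: lorentz_cone_iff L2_set_def)
  moreover have "t \<cdot>\<^sub>v x \<in> lorentz_cone n" if x: "x \<in> lorentz_cone n" and t: "t \<ge> 0" for x t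
  proof -
    have "L2_set (\<lambda>i. (t \<cdot>\<^sub>v x) $ Suc i) {..<n} = t * L2_set (\<lambda>i. x $ Suc i) {..<n}"
      using x t by (subst L2_set_right_distrib) (auto simp: lorentz_cone_iff intro!: L2_set_cong)
    then show ?thesis
      using x t by (auto simp: lorentz_cone_iff intro: mult_left_mono)
  qed
  ultimately show ?thesis
    unfolding cone_in_def by (blast intro: lorentz_cone_iff[THEN iffD1, THEN conjunct1])
qed

lemma lorentz_cone_add:
  assumes "x \<in> lorentz_cone n" "y \<in> lorentz_cone n"
  shows "x + y \<in> lorentz_cone n"
proof -
  have "L2_set (\<lambda>i. (x + y) $ Suc i) {..<n} = L2_set (\<lambda>i. x $ Suc i + y $ Suc i) {..<n}"
    using assms by (auto simp: lorentz_cone_iff intro!: L2_set_cong)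
  then show ?thesis
    using assms L2_set_triangle_ineq[of "\<lambda>i. x $ Suc i" "\<lambda>i. y $ Suc i" "{..<n}"]
    by (auto simp: lorentz_cone_iff)
qed

lemma regular_lorentz: "regular_cone (Suc n) (lorentz_cone n)"
  unfolding regular_cone_def
proof (intro conjI)
  show "cone_in (Suc n) (lorentz_cone n)"
    by (rule cone_lorentz)
  then show "convex_in (Suc n) (lorentz_cone n)"
    unfolding convex_in_def cone_in_def by (auto intro!: lorentz_cone_add)
  show "closedin (euclid_top (Suc n)) (lorentz_cone n)"
    unfolding closedin_def topspace_euclid_top
    using openin_complement_lorentz by (auto simp: lorentz_cone_iff)
  have "unit_vec (Suc n) 0 \<in> {x \<in> carrier_vec (Suc n). L2_set (\<lambda>i. x $ Suc i) {..<n} < x $ 0}"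
    by (simp add: L2_set_def)
  moreover have "{x \<in> carrier_vec (Suc n). L2_set (\<lambda>i. x $ Suc i) {..<n} < x $ 0}
      \<subseteq> euclid_top (Suc n) interior_of lorentz_cone n"
    by (rule interior_of_maximal[OF _ openin_strict_lorentz]) (auto simp: lorentz_cone_iff)
  ultimately show "euclid_top (Suc n) interior_of lorentz_cone n \<noteq> {}"
    by blast
  have "x = 0\<^sub>v (Suc n)" if x: "x \<in> lorentz_cone n" and y: "- x \<in> lorentz_cone n" for x
  proof -
    have "0 \<le> L2_set (\<lambda>i. x $ Suc i) {..<n}" "0 \<le> L2_set (\<lambda>i. (- x) $ Suc i) {..<n}"
      by (rule L2_set_nonneg)+
    moreover have "L2_set (\<lambda>i. x $ Suc i) {..<n} \<le> x $ 0"
      "L2_set (\<lambda>i. (- x) $ Suc i) {..<n} \<le> - x $ 0"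
      using x y by (auto simp: lorentz_cone_iff)
    ultimately have "x $ 0 = 0" and L: "L2_set (\<lambda>i. x $ Suc i) {..<n} = 0"
      by linarith+
    moreover have "x $ Suc i = 0" if "i < n" for i
      using L that by (auto simp: L2_set_eq_0_iff)
    ultimately have "x $ i = 0" if "i < Suc n" for i
      using that by (cases i) auto
    then show ?thesis
      using x by (intro eq_vecI) (auto simp: lorentz_cone_iff)
  qed
  moreover have zero: "0\<^sub>v (Suc n) \<in> lorentz_cone n"
    and minus0: "- 0\<^sub>v (Suc n) = (0\<^sub>v (Suc n) :: real vec)"
    by (auto simp: lorentz_cone_iff L2_set_def)
  moreover have "- x \<in> lorentz_cone n" if "x \<in> uminus ` lorentz_cone n" for x
    using that by auto
  ultimately have "lorentz_cone n \<inter> uminus ` lorentz_cone n \<subseteq> {0\<^sub>v (Suc n)}"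
    by blast
  moreover have "0\<^sub>v (Suc n) \<in> uminus ` lorentz_cone n"
    by (rule rev_image_eqI[OF zero]) (simp only: minus0)
  ultimately show "lorentz_cone n \<inter> uminus ` lorentz_cone n = {0\<^sub>v (Suc n)}"
    using zero by blast
qed

end

theory Submission
  imports Defs
begin

text \<open>
  For \<open>x\<close> feasible in (P) and \<open>y\<close> feasible in (D), the duality gap is the sum over the blocks of
  the nonnegative numbers \<open>y\<^sup>j \<bullet> (A\<^sup>j x - b\<^sup>j)\<close>, so complementarity means gap zero. The gap is the
  difference of a term in \<open>x\<close> and a term in \<open>y\<close>; hence the gaps of \<open>(x, y')\<close> and \<open>(x', y)\<close> add up
  to those of \<open>(x, y)\<close> and \<open>(x', y')\<close>, and \<open>S(C)\<close> is a product
  (\<open>complementary_solutions_exchange\<close>). Everything else happens inside one block, with a slack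
  \<open>s\<close> and a multiplier \<open>y\<close> in the self-dual Lorentz cone and \<open>y \<bullet> s = 0\<close>.

  Let \<open>j\<close> be in \<open>C\<close>. Some solution has \<open>s \<noteq> 0\<close> and some solution has \<open>y \<noteq> 0\<close>; by the product
  structure a single one has both. Equality in the Cauchy-Schwarz inequality then shows that
  \<open>y\<close>, like every vector of the cone orthogonal to \<open>s\<close>, is a multiple of the mirror image
  \<open>(s\<^sub>0, - s\<^sub>1, \<dots>, - s\<^sub>n)\<close> of \<open>s\<close>. So the normal cone at \<open>s\<close> is the ray through \<open>- y\<close>, and
  \<open>- y\<close> is in its relative interior: \<open>j\<close> is in \<open>R\<^sup>0\<close>
  (\<open>lorentz_nonzero_imp_strictly_complementary\<close>). A solution with interior slack would, by the
  product structure again, be orthogonal to this nonzero \<open>y\<close>, which is impossible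
  (\<open>orthogonal_to_interior_eq_0\<close>); so \<open>j\<close> is not in \<open>B\<close>, and dually not in \<open>N\<close>.

  Conversely let \<open>- y\<close> be in the relative interior of the normal cone at \<open>s\<close>. If \<open>s = 0\<close>, this
  normal cone is the negative of the dual cone, so \<open>y\<close> is interior to the dual cone and \<open>j\<close> is
  in \<open>N\<close> (\<open>lorentz_strictly_complementary_at_0\<close>). If \<open>s \<noteq> 0\<close> and \<open>y = 0\<close>, then \<open>s\<close> cannot be on
  the boundary, since there the normal cone is a proper ray with \<open>0\<close> as its end point; so \<open>j\<close> is
  in \<open>B\<close> (\<open>lorentz_0_strictly_complementary\<close>). Outside \<open>B \<union> N\<close> both \<open>s\<close> and \<open>y\<close> are therefore
  nonzero, which is membership in \<open>C\<close>.
\<close>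

section \<open>Moving a point of a relatively open set\<close>

lemma open_perturbation:
  assumes U: "openin (euclid_top m) U" and p: "p \<in> U" and d: "d \<in> carrier_vec m"
  shows "\<exists>\<epsilon>>0. p + \<epsilon> \<cdot>\<^sub>v d \<in> U"
proof -
  have pc: "p \<in> carrier_vec m"
    using U p by (auto simp: openin_euclid_top)
  obtain e where e: "e > 0" "\<And>z. z \<in> carrier_vec m \<Longrightarrow> euclid_dist m p z < e \<Longrightarrow> z \<in> U"
    using U p unfolding openin_euclid_top by blast
  define D where "D = L2_set (\<lambda>i. d $ i) {..<m}"
  \<comment> \<open>The summand 1 keeps the denominator positive when \<open>d = 0\<close>.\<close>
  define \<epsilon> where "\<epsilon> = e / (D + 1)"
  have D: "D \<ge> 0"
    by (simp add: D_def)
  then have \<epsilon>: "\<epsilon> > 0"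
    using e(1) by (simp add: \<epsilon>_def)
  have "euclid_dist m p (p + \<epsilon> \<cdot>\<^sub>v d) = L2_set (\<lambda>i. \<epsilon> * d $ i) {..<m}"
    unfolding euclid_dist_def L2_set_def using pc d by (auto intro!: sum.cong)
  also have "\<dots> = \<epsilon> * D"
    using \<epsilon> by (simp add: D_def L2_set_right_distrib)
  also have "\<dots> < e"
    using e(1) D by (simp add: \<epsilon>_def field_simps)
  finally have "p + \<epsilon> \<cdot>\<^sub>v d \<in> U"
    using pc d by (intro e(2)) auto
  with \<epsilon> show ?thesis
    by blast
qed

lemma interior_perturbation:
  assumes "p \<in> euclid_top m interior_of Q" and "d \<in> carrier_vec m"
  shows "\<exists>\<epsilon>>0. p + \<epsilon> \<cdot>\<^sub>v d \<in> Q"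
  using open_perturbation[OF openin_interior_of assms] interior_of_subset[of "euclid_top m" Q]
  by blast

text \<open>
  The segment from \<open>q\<close> to \<open>p\<close> can be prolonged beyond \<open>p\<close> inside \<open>Q\<close>: the prolonged point is an
  affine combination of \<open>p\<close> and \<open>q\<close>, so it stays in the affine hull, in which \<open>Q\<close> contains a
  neighbourhood of \<open>p\<close>. This is how relative interior points are used below.
\<close>

lemma rel_interior_extension:
  assumes p: "p \<in> rel_interior_in m Q" and q: "q \<in> Q" "q \<in> carrier_vec m"
  shows "\<exists>\<epsilon>>0. p + \<epsilon> \<cdot>\<^sub>v (p - q) \<in> Q"
proof -
  obtain U where U: "openin (euclid_top m) U" "p \<in> U" "p \<in> affine_in m hull Q"
      and sub: "U \<inter> affine_in m hull Q \<subseteq> Q"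
    using p unfolding rel_interior_in_def interior_of_def openin_subtopology by blast
  have pc: "p \<in> carrier_vec m"
    using U(1,2) by (auto simp: openin_euclid_top)
  obtain \<epsilon> where \<epsilon>: "\<epsilon> > 0" "p + \<epsilon> \<cdot>\<^sub>v (p - q) \<in> U"
    using open_perturbation[OF U(1,2), of "p - q"] pc q(2) by auto
  have eq: "p + \<epsilon> \<cdot>\<^sub>v (p - q) = (1 + \<epsilon>) \<cdot>\<^sub>v p + (- \<epsilon>) \<cdot>\<^sub>v q"
    using pc q(2) by (intro eq_vecI) (auto simp: algebra_simps)
  have "p + \<epsilon> \<cdot>\<^sub>v (p - q) \<in> T" if T: "affine_in m T" "Q \<subseteq> T" for T
  proof -
    have "p \<in> T"
      using U(3) hull_minimal[OF T(2), of "affine_in m"] T(1) by blast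
    moreover have "q \<in> T"
      using q(1) T(2) by blast
    moreover have "(1 + \<epsilon>) + (- \<epsilon>) = 1"
      by simp
    ultimately show ?thesis
      unfolding eq using T(1) unfolding affine_in_def by blast
  qed
  then have "p + \<epsilon> \<cdot>\<^sub>v (p - q) \<in> affine_in m hull Q"
    unfolding hull_def by blast
  with \<epsilon> sub show ?thesis
    by blast
qed

section \<open>Complementarity at interior points\<close>

text \<open>
  From an interior point \<open>s\<close> one can move a little in the direction \<open>- y\<close> without leaving \<open>Q\<close>;
  pairing with \<open>y\<close> yields \<open>- \<epsilon> (y \<bullet> y) \<ge> 0\<close>.
\<close>

lemma orthogonal_to_interior_eq_0:
  assumes s: "s \<in> euclid_top m interior_of Q" and y: "y \<in> dual_cone m Q" and orth: "y \<bullet> s = 0"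
  shows "y = 0\<^sub>v m"
proof -
  have yc: "y \<in> carrier_vec m"
    using y by (simp add: dual_cone_def)
  have sc: "s \<in> carrier_vec m"
    using s interior_of_subset_topspace[of "euclid_top m" Q] by (auto simp: topspace_euclid_top)
  obtain \<epsilon> where \<epsilon>: "\<epsilon> > 0" "s + \<epsilon> \<cdot>\<^sub>v (- y) \<in> Q"
    using interior_perturbation[OF s, of "- y"] yc by auto
  have "0 \<le> y \<bullet> (s + \<epsilon> \<cdot>\<^sub>v (- y))"
    using y \<epsilon>(2) by (auto simp: dual_cone_def)
  also have "\<dots> = - (\<epsilon> * (y \<bullet> y))"
    using yc sc orth by (simp add: scalar_prod_add_distrib[of _ m])
  finally have "y \<bullet> y \<le> 0"
    using \<epsilon>(1) by (simp add: mult_le_0_iff)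
  then have "euclid_norm y = 0"
    using L2_set_nonneg[of "\<lambda>i. y $ i" "{..<dim_vec y}"]
    by (simp add: euclid_norm_scalar_prod flip: euclid_norm_def)
  then show ?thesis
    using yc by (intro eq_vecI) (auto simp: euclid_norm_def L2_set_eq_0_iff)
qed

text \<open>
  The preceding lemma for the dual cone, since \<open>Q\<close> lies in its bidual.
\<close>

lemma orthogonal_to_dual_interior_eq_0:
  assumes Q: "Q \<subseteq> carrier_vec m" and s: "s \<in> Q"
    and y: "y \<in> euclid_top m interior_of dual_cone m Q" and orth: "y \<bullet> s = 0"
  shows "s = 0\<^sub>v m"
proof (rule orthogonal_to_interior_eq_0[OF y])
  have "y \<in> carrier_vec m"
    using y interior_of_subset_topspace[of "euclid_top m"] by (auto simp: topspace_euclid_top)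
  then show "s \<bullet> y = 0"
    using orth Q s comm_scalar_prod[of s m y] by auto
  show "s \<in> dual_cone m (dual_cone m Q)"
    using Q s by (auto simp: dual_cone_def) (metis comm_scalar_prod subsetD)
qed

section \<open>Geometry of the Lorentz cone\<close>

lemma scalar_prod_Suc:
  fixes y z :: "real vec"
  assumes "z \<in> carrier_vec (Suc n)"
  shows "y \<bullet> z = y $ 0 * z $ 0 + (\<Sum>i<n. y $ Suc i * z $ Suc i)"
  using assms by (simp add: scalar_prod_def atLeast0LessThan sum.lessThan_Suc_shift del: sum.lessThan_Suc)

lemma lorentz_carrier: "x \<in> lorentz_cone n \<Longrightarrow> x \<in> carrier_vec (Suc n)"
  by (simp add: lorentz_cone_iff)

lemma lorentz_head_pos:
  assumes x: "x \<in> lorentz_cone n" and "x \<noteq> 0\<^sub>v (Suc n)"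
  shows "x $ 0 > 0"
proof (rule ccontr)
  assume "\<not> x $ 0 > 0"
  moreover have L: "L2_set (\<lambda>i. x $ Suc i) {..<n} \<le> x $ 0"
    using x by (simp add: lorentz_cone_iff)
  ultimately have "x $ 0 = 0" "L2_set (\<lambda>i. x $ Suc i) {..<n} = 0"
    using L2_set_nonneg[of "\<lambda>i. x $ Suc i" "{..<n}"] by linarith+
  then have "x $ i = 0" if "i < Suc n" for i
    using that by (cases i) (auto simp: L2_set_eq_0_iff)
  then show False
    using assms lorentz_carrier[OF x] by (auto intro!: eq_vecI)
qed

lemma lorentz_head_nonneg: "x \<in> lorentz_cone n \<Longrightarrow> 0 \<le> x $ 0"
  by (meson L2_set_nonneg lorentz_cone_iff order_trans)

lemma lorentz_tail_sum_le:
  assumes "x \<in> lorentz_cone n"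
  shows "(\<Sum>i<n. (x $ Suc i)\<^sup>2) \<le> (x $ 0)\<^sup>2"
proof -
  have "L2_set (\<lambda>i. x $ Suc i) {..<n} \<le> x $ 0"
    using assms by (simp add: lorentz_cone_iff)
  then show ?thesis
    unfolding L2_set_def using sqrt_le_D by blast
qed

lemma lorentz_scalar_prod_nonneg:
  assumes y: "y \<in> lorentz_cone n" and z: "z \<in> lorentz_cone n"
  shows "0 \<le> y \<bullet> z"
proof -
  let ?Y = "L2_set (\<lambda>i. y $ Suc i) {..<n}" and ?Z = "L2_set (\<lambda>i. z $ Suc i) {..<n}"
  have "- (\<Sum>i<n. y $ Suc i * z $ Suc i) \<le> (\<Sum>i<n. \<bar>y $ Suc i\<bar> * \<bar>z $ Suc i\<bar>)"
    unfolding sum_negf[symmetric] by (rule sum_mono) (simp flip: abs_mult)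
  also have "\<dots> \<le> ?Y * ?Z"
    by (rule L2_set_mult_ineq)
  also have "\<dots> \<le> y $ 0 * z $ 0"
    using y z lorentz_head_nonneg[OF y] by (intro mult_mono) (auto simp: lorentz_cone_iff)
  finally show ?thesis
    by (simp add: scalar_prod_Suc[OF lorentz_carrier[OF z]])
qed

text \<open>
  The cone vectors orthogonal to a nonzero boundary vector \<open>x\<close> are the nonnegative multiples of
  this mirror image of \<open>x\<close> in the axis of the cone.
\<close>

definition lorentz_reflection :: "nat \<Rightarrow> real vec \<Rightarrow> real vec" where
  "lorentz_reflection n x = vec (Suc n) (\<lambda>i. if i = 0 then x $ 0 else - x $ i)"

lemma lorentz_reflection_simps [simp]:
  "lorentz_reflection n x \<in> carrier_vec (Suc n)"
  "lorentz_reflection n x $ 0 = x $ 0"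
  "i < n \<Longrightarrow> lorentz_reflection n x $ Suc i = - x $ Suc i"
  by (auto simp: lorentz_reflection_def)

lemma lorentz_reflection_in_cone:
  assumes "x \<in> lorentz_cone n"
  shows "lorentz_reflection n x \<in> lorentz_cone n"
  using assms by (simp add: lorentz_cone_iff L2_set_def)

text \<open>
  That \<open>y\<close> in the dual cone lies in the cone is seen from two test vectors. With tail norm \<open>r\<close>,
  pairing \<open>y\<close> with \<open>(r, - y\<^sub>1, \<dots>, - y\<^sub>n)\<close> gives \<open>(y\<^sub>0 - r) r \<ge> 0\<close>; if \<open>r = 0\<close> this says
  nothing, and the axis vector gives \<open>y\<^sub>0 \<ge> 0\<close>.
\<close>

lemma dual_lorentz_cone: "dual_cone (Suc n) (lorentz_cone n) = lorentz_cone n"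
proof (intro equalityI subsetI)
  fix y assume "y \<in> lorentz_cone n"
  then show "y \<in> dual_cone (Suc n) (lorentz_cone n)"
    by (auto simp: dual_cone_def lorentz_scalar_prod_nonneg lorentz_carrier)
next
  fix y assume y: "y \<in> dual_cone (Suc n) (lorentz_cone n)"
  then have yc: "y \<in> carrier_vec (Suc n)"
    by (simp add: dual_cone_def)
  let ?r = "L2_set (\<lambda>i. y $ Suc i) {..<n}"
  define z where "z = lorentz_reflection n (vec (Suc n) (\<lambda>i. if i = 0 then ?r else y $ i))"
  have z: "z $ 0 = ?r" "\<And>i. i < n \<Longrightarrow> z $ Suc i = - y $ Suc i" "z \<in> carrier_vec (Suc n)"
    by (auto simp: z_def)
  have "z \<in> lorentz_cone n"
    using z by (simp add: lorentz_cone_iff L2_set_def)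
  then have "0 \<le> y \<bullet> z"
    using y by (auto simp: dual_cone_def)
  also have "y \<bullet> z = y $ 0 * ?r - (\<Sum>i<n. (y $ Suc i)\<^sup>2)"
    using z by (simp add: scalar_prod_Suc sum_negf power2_eq_square)
  also have "(\<Sum>i<n. (y $ Suc i)\<^sup>2) = ?r * ?r"
    by (simp add: L2_set_def sum_nonneg)
  finally have *: "0 \<le> (y $ 0 - ?r) * ?r"
    by (simp add: algebra_simps)
  have "unit_vec (Suc n) 0 \<in> lorentz_cone n"
    by (simp add: lorentz_cone_iff L2_set_def)
  then have "0 \<le> y \<bullet> unit_vec (Suc n) 0"
    using y by (auto simp: dual_cone_def)
  then have "0 \<le> y $ 0"
    using yc by simp
  then have "?r \<le> y $ 0"
    using * L2_set_nonneg[of "\<lambda>i. y $ Suc i" "{..<n}"]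
    by (cases "?r = 0") (auto simp: zero_le_mult_iff)
  then show "y \<in> lorentz_cone n"
    using yc by (simp add: lorentz_cone_iff)
qed

text \<open>
  The case of equality in the Cauchy-Schwarz inequality: the squared norm of \<open>s\<^sub>0 y + y\<^sub>0 s\<close> over
  the tail coordinates is at most \<open>2 s\<^sub>0\<^sup>2 y\<^sub>0\<^sup>2\<close> plus \<open>2 s\<^sub>0 y\<^sub>0\<close> times the inner product of the
  tails, and orthogonality makes that inner product \<open>- s\<^sub>0 y\<^sub>0\<close>.
\<close>

lemma lorentz_orthogonal_antiparallel:
  assumes s: "s \<in> lorentz_cone n" and y: "y \<in> lorentz_cone n" and orth: "y \<bullet> s = 0"
  shows "s $ 0 \<cdot>\<^sub>v y = y $ 0 \<cdot>\<^sub>v lorentz_reflection n s"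
proof -
  have cross: "(\<Sum>i<n. y $ Suc i * s $ Suc i) = - (y $ 0 * s $ 0)"
    using orth by (simp add: scalar_prod_Suc[OF lorentz_carrier[OF s]])
  have "(\<Sum>i<n. (s $ 0 * y $ Suc i + y $ 0 * s $ Suc i)\<^sup>2) =
      (s $ 0)\<^sup>2 * (\<Sum>i<n. (y $ Suc i)\<^sup>2) + (y $ 0)\<^sup>2 * (\<Sum>i<n. (s $ Suc i)\<^sup>2)
        + 2 * s $ 0 * y $ 0 * (\<Sum>i<n. y $ Suc i * s $ Suc i)"
    unfolding sum_distrib_left sum.distrib[symmetric]
    by (rule sum.cong) (auto simp: power2_eq_square algebra_simps)
  also have "\<dots> \<le> (s $ 0)\<^sup>2 * (y $ 0)\<^sup>2 + (y $ 0)\<^sup>2 * (s $ 0)\<^sup>2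
        + 2 * s $ 0 * y $ 0 * (\<Sum>i<n. y $ Suc i * s $ Suc i)"
    by (intro add_right_mono add_mono mult_left_mono lorentz_tail_sum_le s y) auto
  also have "\<dots> = 0"
    unfolding cross by (simp add: power2_eq_square)
  finally have "(\<Sum>i<n. (s $ 0 * y $ Suc i + y $ 0 * s $ Suc i)\<^sup>2) = 0"
    by (intro antisym sum_nonneg) auto
  then have tail: "s $ 0 * y $ Suc i = - (y $ 0 * s $ Suc i)" if "i < n" for i
    using that by (force simp: sum_nonneg_eq_0_iff)
  show ?thesis
  proof (rule eq_vecI)
    fix i assume "i < dim_vec (y $ 0 \<cdot>\<^sub>v lorentz_reflection n s)"
    then have "i < Suc n"
      by (simp add: lorentz_reflection_def)
    then show "(s $ 0 \<cdot>\<^sub>v y) $ i = (y $ 0 \<cdot>\<^sub>v lorentz_reflection n s) $ i"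
      using lorentz_carrier[OF y] tail by (cases i) (auto simp: lorentz_reflection_def)
  qed (use lorentz_carrier[OF y] in \<open>simp add: lorentz_reflection_def\<close>)
qed

lemma lorentz_strict_interior:
  assumes "x \<in> lorentz_cone n" and "L2_set (\<lambda>i. x $ Suc i) {..<n} < x $ 0"
  shows "x \<in> euclid_top (Suc n) interior_of lorentz_cone n"
proof -
  have "{x \<in> carrier_vec (Suc n). L2_set (\<lambda>i. x $ Suc i) {..<n} < x $ 0}
      \<subseteq> euclid_top (Suc n) interior_of lorentz_cone n"
    by (rule interior_of_maximal[OF _ openin_strict_lorentz]) (auto simp: lorentz_cone_iff)
  then show ?thesis
    using assms lorentz_carrier by blast
qed

text \<open>
  For a cone, the inequalities \<open>v \<bullet> z \<le> v \<bullet> s\<close> may be scaled in \<open>z\<close>: taking \<open>z = 0\<close> and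
  \<open>z = 2 s\<close> forces \<open>v \<bullet> s = 0\<close>, after which they say that \<open>- v\<close> is in the dual cone, here the
  cone itself.
\<close>

lemma normal_cone_lorentz:
  assumes s: "s \<in> lorentz_cone n"
  shows "normal_cone (Suc n) (lorentz_cone n) s = {v. - v \<in> lorentz_cone n \<and> v \<bullet> s = 0}"
proof (intro equalityI subsetI)
  have sc: "s \<in> carrier_vec (Suc n)"
    by (rule lorentz_carrier[OF s])
  fix v
  {
    assume v: "v \<in> normal_cone (Suc n) (lorentz_cone n) s"
    then have vc: "v \<in> carrier_vec (Suc n)"
      and le: "\<And>z. z \<in> lorentz_cone n \<Longrightarrow> v \<bullet> z \<le> v \<bullet> s"
      using sc by (auto simp: normal_cone_def scalar_prod_minus_distrib[of _ "Suc n"] lorentz_carrier)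
    have scale: "t * (v \<bullet> z) \<le> v \<bullet> s" if z: "z \<in> lorentz_cone n" and "t \<ge> 0" for t z
      using le[of "t \<cdot>\<^sub>v z"] that cone_lorentz[of n] lorentz_carrier[OF z] vc
      by (auto simp: cone_in_def)
    have vs: "v \<bullet> s = 0"
      using scale[OF s, of 0] scale[OF s, of 2] by simp
    have "(- v) \<bullet> z \<ge> 0" if z: "z \<in> lorentz_cone n" for z
      using scale[OF z, of 1] vs vc lorentz_carrier[OF z] by simp
    then have "- v \<in> lorentz_cone n"
      using vc by (subst dual_lorentz_cone[symmetric]) (auto simp: dual_cone_def)
    with vs show "v \<in> {v. - v \<in> lorentz_cone n \<and> v \<bullet> s = 0}"
      by simp
  }
  {
    assume "v \<in> {v. - v \<in> lorentz_cone n \<and> v \<bullet> s = 0}"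
    then have v: "- v \<in> lorentz_cone n" and vs: "v \<bullet> s = 0"
      by auto
    have vc: "v \<in> carrier_vec (Suc n)"
      using lorentz_carrier[OF v] by simp
    have "v \<bullet> (z - s) \<le> 0" if z: "z \<in> lorentz_cone n" for z
      using lorentz_scalar_prod_nonneg[OF v z] vs vc sc lorentz_carrier[OF z]
      by (simp add: scalar_prod_minus_distrib[of _ "Suc n"])
    with vc show "v \<in> normal_cone (Suc n) (lorentz_cone n) s"
      by (simp add: normal_cone_def)
  }
qed

section \<open>Strict complementarity in one block\<close>

text \<open>
  The negative of a normal vector and \<open>y\<close> are both multiples of the mirror image of \<open>s\<close>, hence
  proportional to each other. The line bounds the affine hull of the normal cone.
\<close>

lemma lorentz_normal_cone_subset_line:
  assumes s: "s \<in> lorentz_cone n" and s0: "s \<noteq> 0\<^sub>v (Suc n)"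
    and y: "y \<in> lorentz_cone n" and y0: "y \<noteq> 0\<^sub>v (Suc n)" and orth: "y \<bullet> s = 0"
  shows "normal_cone (Suc n) (lorentz_cone n) s \<subseteq> range (\<lambda>t. t \<cdot>\<^sub>v y)"
proof
  fix w assume "w \<in> normal_cone (Suc n) (lorentz_cone n) s"
  then have w: "- w \<in> lorentz_cone n" and "w \<bullet> s = 0"
    by (auto simp: normal_cone_lorentz[OF s])
  have wc: "w \<in> carrier_vec (Suc n)" and yc: "y \<in> carrier_vec (Suc n)"
    and sc: "s \<in> carrier_vec (Suc n)"
    using lorentz_carrier[OF w] lorentz_carrier[OF y] lorentz_carrier[OF s] by auto
  have "- w \<bullet> s = 0"
    using \<open>w \<bullet> s = 0\<close> wc sc by simp
  have pos: "s $ 0 > 0" "y $ 0 > 0"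
    using lorentz_head_pos s s0 y y0 by auto
  note anti = lorentz_orthogonal_antiparallel[OF s w \<open>- w \<bullet> s = 0\<close>]
    lorentz_orthogonal_antiparallel[OF s y orth]
  have "w = (w $ 0 / y $ 0) \<cdot>\<^sub>v y"
  proof (rule eq_vecI)
    fix i assume "i < dim_vec ((w $ 0 / y $ 0) \<cdot>\<^sub>v y)"
    then have i: "i < Suc n"
      using yc by simp
    have "s $ 0 * w $ i = w $ 0 * lorentz_reflection n s $ i"
      using arg_cong[OF anti(1), of "\<lambda>v. v $ i"] i wc by (simp add: lorentz_reflection_def)
    then have "s $ 0 * (w $ i * y $ 0) = w $ 0 * (y $ 0 * lorentz_reflection n s $ i)"
      by simp
    also have "y $ 0 * lorentz_reflection n s $ i = s $ 0 * y $ i"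
      using arg_cong[OF anti(2), of "\<lambda>v. v $ i"] i yc by (simp add: lorentz_reflection_def)
    finally have "s $ 0 * (w $ i * y $ 0) = s $ 0 * (w $ 0 * y $ i)"
      by simp
    then show "w $ i = ((w $ 0 / y $ 0) \<cdot>\<^sub>v y) $ i"
      using pos i yc by (simp add: field_simps)
  qed (use wc yc in simp)
  then show "w \<in> range (\<lambda>t. t \<cdot>\<^sub>v y)"
    by blast
qed

lemma affine_in_line:
  assumes "y \<in> carrier_vec m"
  shows "affine_in m (range (\<lambda>t. t \<cdot>\<^sub>v y))"
proof -
  have "u \<cdot>\<^sub>v (a \<cdot>\<^sub>v y) + v \<cdot>\<^sub>v (b \<cdot>\<^sub>v y) = (u * a + v * b) \<cdot>\<^sub>v y" for u v a b
    using assms by (intro eq_vecI) (auto simp: algebra_simps)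
  then show ?thesis
    using assms by (auto simp: affine_in_def)
qed

text \<open>
  The affine hull of the normal cone lies in the line through \<open>y\<close>, and the multiples \<open>t y\<close> with
  \<open>t \<le> 0\<close> are normal vectors. A point \<open>t y\<close> at distance less than \<open>y\<^sub>0\<close> from \<open>- y\<close> has a negative
  leading coordinate, hence \<open>t < 0\<close>; so the ball of radius \<open>y\<^sub>0\<close> shows that \<open>- y\<close> is a relatively
  interior point.
\<close>

lemma lorentz_nonzero_imp_strictly_complementary:
  assumes s: "s \<in> lorentz_cone n" and s0: "s \<noteq> 0\<^sub>v (Suc n)"
    and y: "y \<in> lorentz_cone n" and y0: "y \<noteq> 0\<^sub>v (Suc n)" and orth: "y \<bullet> s = 0"
  shows "- y \<in> rel_interior_in (Suc n) (normal_cone (Suc n) (lorentz_cone n) s)"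
proof -
  let ?N = "normal_cone (Suc n) (lorentz_cone n) s"
  let ?U = "{z \<in> carrier_vec (Suc n). euclid_dist (Suc n) (- y) z < y $ 0}"
  interpret E: Metric_space "carrier_vec (Suc n)" "euclid_dist (Suc n)"
    by (rule Metric_space_euclid)
  have yc: "y \<in> carrier_vec (Suc n)" and sc: "s \<in> carrier_vec (Suc n)"
    using lorentz_carrier[OF y] lorentz_carrier[OF s] .
  have pos: "y $ 0 > 0"
    using lorentz_head_pos y y0 by auto
  have "?U = E.mball (- y) (y $ 0)"
    using yc by (auto simp: E.mball_def)
  then have open_U: "openin (euclid_top (Suc n)) ?U"
    by (simp add: euclid_top_def)
  have inN: "t \<cdot>\<^sub>v y \<in> ?N" if "t \<le> 0" for t
  proof -
    have "- (t \<cdot>\<^sub>v y) = (- t) \<cdot>\<^sub>v y"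
      by auto
    then have "- (t \<cdot>\<^sub>v y) \<in> lorentz_cone n"
      using that cone_lorentz[of n] y by (auto simp: cone_in_def)
    then show ?thesis
      using orth yc sc by (simp add: normal_cone_lorentz[OF s])
  qed
  have "affine_in (Suc n) hull ?N \<subseteq> range (\<lambda>t. t \<cdot>\<^sub>v y)"
    by (intro hull_minimal lorentz_normal_cone_subset_line assms affine_in_line yc)
  moreover have "t \<cdot>\<^sub>v y \<in> ?N" if "euclid_dist (Suc n) (- y) (t \<cdot>\<^sub>v y) < y $ 0" for t
  proof -
    have "\<bar>(- y) $ 0 - (t \<cdot>\<^sub>v y) $ 0\<bar> < y $ 0"
      using euclid_dist_Suc(1) that by (rule le_less_trans)
    then have "t * y $ 0 < 0"
      using yc by auto
    then show ?thesis
      using pos by (intro inN) (auto simp: mult_less_0_iff)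
  qed
  ultimately have "?U \<inter> affine_in (Suc n) hull ?N \<subseteq> ?N"
    by blast
  moreover have "- y = (- 1) \<cdot>\<^sub>v y"
    by auto
  then have "- y \<in> ?N"
    using inN[of "- 1"] by simp
  then have "- y \<in> ?U \<inter> affine_in (Suc n) hull ?N"
    using yc pos by (auto intro: hull_inc)
  ultimately show ?thesis
    using open_U unfolding rel_interior_in_def interior_of_def openin_subtopology by blast
qed

text \<open>
  The normal cone at \<open>0\<close> is the negative cone and contains \<open>- (y + e\<^sub>0)\<close> for the axis vector
  \<open>e\<^sub>0\<close>. Prolonging the segment from there beyond \<open>- y\<close> shows that \<open>y - \<epsilon> e\<^sub>0\<close> is in the cone, so
  the inequality that defines the cone is strict at \<open>y\<close>.
\<close>

lemma lorentz_strictly_complementary_at_0: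
  assumes y: "y \<in> lorentz_cone n"
    and ri: "- y \<in> rel_interior_in (Suc n) (normal_cone (Suc n) (lorentz_cone n) (0\<^sub>v (Suc n)))"
  shows "y \<in> euclid_top (Suc n) interior_of dual_cone (Suc n) (lorentz_cone n)"
proof -
  let ?e = "unit_vec (Suc n) 0 :: real vec"
  let ?N = "normal_cone (Suc n) (lorentz_cone n) (0\<^sub>v (Suc n))"
  have zero: "0\<^sub>v (Suc n) \<in> lorentz_cone n" and e: "?e \<in> lorentz_cone n"
    by (auto simp: lorentz_cone_iff L2_set_def)
  have yc: "y \<in> carrier_vec (Suc n)"
    by (rule lorentz_carrier[OF y])
  have "- (- (y + ?e)) \<in> lorentz_cone n"
    using lorentz_cone_add[OF y e] by simp
  then have "- (y + ?e) \<in> ?N"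
    using yc by (simp add: normal_cone_lorentz[OF zero])
  then obtain \<epsilon> where \<epsilon>: "\<epsilon> > 0" "- y + \<epsilon> \<cdot>\<^sub>v (- y - - (y + ?e)) \<in> ?N"
    using rel_interior_extension[OF ri, of "- (y + ?e)"] yc by auto
  define z where "z = - (- y + \<epsilon> \<cdot>\<^sub>v (- y - - (y + ?e)))"
  have "z \<in> lorentz_cone n"
    using \<epsilon>(2) by (simp add: z_def normal_cone_lorentz[OF zero])
  moreover have "z $ 0 = y $ 0 - \<epsilon>" and "\<And>i. i < n \<Longrightarrow> z $ Suc i = y $ Suc i"
    using yc by (auto simp: z_def)
  ultimately have "L2_set (\<lambda>i. y $ Suc i) {..<n} < y $ 0"
    using \<epsilon>(1) by (simp add: lorentz_cone_iff L2_set_def)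
  then show ?thesis
    unfolding dual_lorentz_cone by (rule lorentz_strict_interior[OF y])
qed

text \<open>
  If \<open>s\<close> were a boundary point, the negative of its mirror image would be a nonzero normal
  vector. Prolonging the segment from it beyond \<open>0\<close> would yield a normal vector with positive
  leading coordinate, whose negative is not in the cone.
\<close>

lemma lorentz_0_strictly_complementary:
  assumes s: "s \<in> lorentz_cone n" and s0: "s \<noteq> 0\<^sub>v (Suc n)"
    and ri: "0\<^sub>v (Suc n) \<in> rel_interior_in (Suc n) (normal_cone (Suc n) (lorentz_cone n) s)"
  shows "s \<in> euclid_top (Suc n) interior_of lorentz_cone n"
proof (rule ccontr)
  let ?v = "lorentz_reflection n s" and ?N = "normal_cone (Suc n) (lorentz_cone n) s"
  assume "s \<notin> euclid_top (Suc n) interior_of lorentz_cone n"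
  then have "L2_set (\<lambda>i. s $ Suc i) {..<n} = s $ 0"
    using lorentz_strict_interior[OF s] s by (fastforce simp: lorentz_cone_iff)
  then have "(\<Sum>i<n. (s $ Suc i)\<^sup>2) = (s $ 0)\<^sup>2"
    unfolding L2_set_def by (metis real_sqrt_pow2 sum_nonneg zero_le_power2)
  then have orth: "?v \<bullet> s = 0"
    by (simp add: scalar_prod_Suc[OF lorentz_carrier[OF s]] sum_negf power2_eq_square)
  have pos: "s $ 0 > 0"
    using lorentz_head_pos s s0 .
  have sc: "s \<in> carrier_vec (Suc n)"
    by (rule lorentz_carrier[OF s])
  have "dim_vec ?v = Suc n"
    by (simp add: lorentz_reflection_def)
  then have "- ?v \<in> ?N"
    using orth sc lorentz_reflection_in_cone[OF s] by (simp add: normal_cone_lorentz[OF s])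
  then obtain \<epsilon> where \<epsilon>: "\<epsilon> > 0" "0\<^sub>v (Suc n) + \<epsilon> \<cdot>\<^sub>v (0\<^sub>v (Suc n) - - ?v) \<in> ?N"
    using rel_interior_extension[OF ri, of "- ?v"] by auto
  then have "- (0\<^sub>v (Suc n) + \<epsilon> \<cdot>\<^sub>v (0\<^sub>v (Suc n) - - ?v)) \<in> lorentz_cone n"
    by (simp add: normal_cone_lorentz[OF s])
  from lorentz_head_nonneg[OF this] have "0 \<le> - (\<epsilon> * s $ 0)"
    by (simp add: \<open>dim_vec ?v = Suc n\<close>)
  then show False
    using \<epsilon>(1) pos by (simp add: mult_le_0_iff)
qed

section \<open>The complementary solutions form a product\<close>

lemma adjoint_sum_scalar_prod:
  assumes wf: "conic_problem_wf P" and x: "x \<in> carrier_vec (nvars P)"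
    and y: "\<And>j. j \<in> blocks P \<Longrightarrow> y j \<in> carrier_vec (bdim P j)"
  shows "adjoint_sum P y \<bullet> x = (\<Sum>j\<in>blocks P. y j \<bullet> (Amat P j *\<^sub>v x))"
proof -
  let ?v = "\<lambda>j. transpose_mat (Amat P j) *\<^sub>v y j"
  have A: "Amat P j \<in> carrier_mat (bdim P j) (nvars P)" if "j \<in> blocks P" for j
    using wf that by (auto simp: conic_problem_wf_def)
  have v: "?v \<in> blocks P \<rightarrow> carrier_vec (nvars P)"
    using A y by (auto intro!: mult_mat_vec_carrier)
  have fin: "finite (blocks P)"
    by (simp add: blocks_def)
  have "adjoint_sum P y \<bullet> x = (\<Sum>i<nvars P. (\<Sum>j\<in>blocks P. ?v j $ i) * x $ i)"
    using x by (simp add: scalar_prod_def adjoint_sum_def index_finsum_vec[OF fin _ v] atLeast0LessThan)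
  also have "\<dots> = (\<Sum>i<nvars P. \<Sum>j\<in>blocks P. ?v j $ i * x $ i)"
    by (simp add: sum_distrib_right)
  also have "\<dots> = (\<Sum>j\<in>blocks P. \<Sum>i<nvars P. ?v j $ i * x $ i)"
    by (rule sum.swap)
  also have "\<dots> = (\<Sum>j\<in>blocks P. ?v j \<bullet> x)"
    using x by (simp add: scalar_prod_def atLeast0LessThan)
  also have "\<dots> = (\<Sum>j\<in>blocks P. y j \<bullet> (Amat P j *\<^sub>v x))"
    by (rule sum.cong[OF refl]) (rule transpose_vec_mult_scalar[OF A x y])
  finally show ?thesis .
qed

lemma duality_gap_eq_complementarity_sum:
  assumes wf: "conic_problem_wf P" and x: "x \<in> carrier_vec (nvars P)"
    and y: "\<And>j. j \<in> blocks P \<Longrightarrow> y j \<in> carrier_vec (bdim P j)"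
    and adj: "adjoint_sum P y = cvec P"
  shows "primal_objective P x - dual_objective P y = (\<Sum>j\<in>blocks P. y j \<bullet> slack P x j)"
proof -
  have "y j \<bullet> slack P x j = y j \<bullet> (Amat P j *\<^sub>v x) - bvec P j \<bullet> y j" if j: "j \<in> blocks P" for j
  proof -
    have "Amat P j *\<^sub>v x \<in> carrier_vec (bdim P j)" "bvec P j \<in> carrier_vec (bdim P j)"
      using wf j x by (auto simp: conic_problem_wf_def intro: mult_mat_vec_carrier)
    then show ?thesis
      using y[OF j] by (simp add: slack_def scalar_prod_minus_distrib[of _ "bdim P j"]
        comm_scalar_prod[of "y j" _ "bvec P j"])
  qed
  then have "(\<Sum>j\<in>blocks P. y j \<bullet> slack P x j) = adjoint_sum P y \<bullet> x - dual_objective P y"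
    using adjoint_sum_scalar_prod[OF wf x y]
    by (simp add: sum_subtractf dual_objective_def)
  then show ?thesis
    by (simp add: adj primal_objective_def)
qed

text \<open>
  A sum of nonnegative terms vanishes only if each term does, so the blockwise complementarity
  conditions are equivalent to one inequality between the objective values. Only in this form do
  the conditions separate \<open>x\<close> from \<open>y\<close>.
\<close>

lemma complementary_solutions_iff_gap:
  assumes wf: "conic_problem_wf P"
  shows "(x, y) \<in> complementary_solutions P \<longleftrightarrow>
    x \<in> primal_feasible P \<and> y \<in> dual_feasible P \<and> primal_objective P x \<le> dual_objective P y"
proof -
  {
    assume x: "x \<in> primal_feasible P" and y: "y \<in> dual_feasible P"
    have carr: "y j \<in> carrier_vec (bdim P j)" if "j \<in> blocks P" for j
      using y that by (auto simp: dual_feasible_def)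
    have gap: "primal_objective P x - dual_objective P y = (\<Sum>j\<in>blocks P. y j \<bullet> slack P x j)"
      using x y carr by (intro duality_gap_eq_complementarity_sum wf)
        (auto simp: primal_feasible_def dual_feasible_def)
    have nonneg: "0 \<le> y j \<bullet> slack P x j" if "j \<in> blocks P" for j
      using x y that by (auto simp: primal_feasible_def dual_feasible_def dual_cone_def)
    have "primal_objective P x \<le> dual_objective P y \<longleftrightarrow> (\<Sum>j\<in>blocks P. y j \<bullet> slack P x j) = 0"
      using gap sum_nonneg[of "blocks P" "\<lambda>j. y j \<bullet> slack P x j", OF nonneg] by linarith
    also have "\<dots> \<longleftrightarrow> (\<forall>j\<in>blocks P. y j \<bullet> slack P x j = 0)"
      by (rule sum_nonneg_eq_0_iff) (use nonneg in \<open>auto simp: blocks_def\<close>)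
    finally have "primal_objective P x \<le> dual_objective P y \<longleftrightarrow>
      (\<forall>j\<in>blocks P. y j \<bullet> slack P x j = 0)" .
  }
  then show ?thesis
    unfolding complementary_solutions_def primal_feasible_def dual_feasible_def by blast
qed

lemma weak_duality:
  assumes wf: "conic_problem_wf P" and x: "x \<in> primal_feasible P" and y: "y \<in> dual_feasible P"
  shows "dual_objective P y \<le> primal_objective P x"
proof -
  have "primal_objective P x - dual_objective P y = (\<Sum>j\<in>blocks P. y j \<bullet> slack P x j)"
    using x y by (intro duality_gap_eq_complementarity_sum wf)
      (auto simp: primal_feasible_def dual_feasible_def)
  also have "\<dots> \<ge> 0"
    using x y by (intro sum_nonneg) (auto simp: primal_feasible_def dual_feasible_def dual_cone_def)
  finally show ?thesis
    by simp
qed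

text \<open>
  With \<open>p\<close> and \<open>d\<close> for the objective values, \<open>p x \<le> d y \<le> p x' \<le> d y'\<close>, where the middle
  inequality is weak duality for \<open>(x', y)\<close>.
\<close>

lemma complementary_solutions_exchange:
  assumes wf: "conic_problem_wf P"
    and "(x, y) \<in> complementary_solutions P" and "(x', y') \<in> complementary_solutions P"
  shows "(x, y') \<in> complementary_solutions P"
  using assms(2,3) weak_duality[OF wf, of x' y]
  unfolding complementary_solutions_iff_gap[OF wf] by auto

section \<open>The index sets\<close>

theorem proposition3:
  fixes P :: conic_problem
  assumes "conic_problem_wf P"
    and "strong_duality P"
    and "\<forall>j\<in>blocks P. \<exists>n. bdim P j = Suc n \<and> Kcone P j = lorentz_cone n"
  shows "R_set P = C_set P \<and> C_set P = blocks P - (B0_set P \<union> N0_set P)"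
proof (intro conjI equalityI subsetI)
  fix j assume j: "j \<in> R_set P"
  then have jb: "j \<in> blocks P" and jB: "j \<notin> B_set P" and jN: "j \<notin> N_set P"
    by (auto simp: R_set_def R0_set_def)
  obtain x y where xy: "(x, y) \<in> complementary_solutions P"
    and ri: "- y j \<in> rel_interior_in (bdim P j) (normal_cone (bdim P j) (Kcone P j) (slack P x j))"
    using j by (auto simp: R_set_def R0_set_def)
  obtain n where n: "bdim P j = Suc n" "Kcone P j = lorentz_cone n"
    using assms(3) jb by blast
  have s: "slack P x j \<in> lorentz_cone n" and y: "y j \<in> lorentz_cone n"
    using xy jb n by (auto simp: complementary_solutions_def dual_lorentz_cone)
  have "slack P x j \<noteq> 0\<^sub>v (Suc n)"
    using lorentz_strictly_complementary_at_0[OF y] ri jN jb xy n by (auto simp: N_set_def)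
  moreover from this have "y j \<noteq> 0\<^sub>v (Suc n)"
    using lorentz_0_strictly_complementary[OF s] ri jB jb xy n by (auto simp: B_set_def)
  \<comment> \<open>The solution \<open>(x, y)\<close> serves as the witness against both \<open>B0_set\<close> and \<open>N0_set\<close>.\<close>
  ultimately show "j \<in> C_set P"
    using jb xy n by (auto simp: C_set_def B0_set_def N0_set_def)
next
  fix j assume j: "j \<in> C_set P"
  then have jb: "j \<in> blocks P"
    by (simp add: C_set_def)
  obtain n where n: "bdim P j = Suc n" "Kcone P j = lorentz_cone n"
    using assms(3) jb by blast
  obtain x y x' y' where xy': "(x, y') \<in> complementary_solutions P" "slack P x j \<noteq> 0\<^sub>v (Suc n)"
    and x'y: "(x', y) \<in> complementary_solutions P" "y j \<noteq> 0\<^sub>v (Suc n)"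
    using j n by (auto simp: C_set_def B0_set_def N0_set_def)
  have mem: "slack P u j \<in> lorentz_cone n" "v j \<in> dual_cone (Suc n) (lorentz_cone n)"
      "v j \<bullet> slack P u j = 0"
    if "(u, v) \<in> complementary_solutions P" for u v
    using that jb n by (auto simp: complementary_solutions_def)
  note exch = complementary_solutions_exchange[OF assms(1)]
  have xy: "(x, y) \<in> complementary_solutions P"
    by (rule exch[OF xy'(1) x'y(1)])
  have "j \<in> R0_set P"
    unfolding R0_set_def
    using lorentz_nonzero_imp_strictly_complementary[OF mem(1)[OF xy] xy'(2)
        mem(2)[OF xy, unfolded dual_lorentz_cone] x'y(2) mem(3)[OF xy]] xy jb n
    by auto
  moreover have "j \<notin> B_set P"
  proof
    assume "j \<in> B_set P"
    then obtain u v where uv: "(u, v) \<in> complementary_solutions P"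
      "slack P u j \<in> euclid_top (Suc n) interior_of lorentz_cone n"
      using n by (auto simp: B_set_def)
    have "(u, y) \<in> complementary_solutions P"
      by (rule exch[OF uv(1) xy])
    then show False
      using orthogonal_to_interior_eq_0[OF uv(2)] mem x'y(2) by blast
  qed
  moreover have "j \<notin> N_set P"
  proof
    assume "j \<in> N_set P"
    then obtain u v where uv: "(u, v) \<in> complementary_solutions P"
      "v j \<in> euclid_top (Suc n) interior_of dual_cone (Suc n) (lorentz_cone n)"
      using n by (auto simp: N_set_def)
    have "(x, v) \<in> complementary_solutions P"
      by (rule exch[OF xy uv(1)])
    then show False
      using orthogonal_to_dual_interior_eq_0[OF _ _ uv(2)] mem xy'(2) lorentz_carrier by blast
  qed
  ultimately show "j \<in> R_set P"
    by (simp add: R_set_def)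
qed (simp_all add: C_set_def)

end
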